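(* Let $Q$ be a $q\times q$ realizable matrix. Then for every $S\subseteq\{1,\dots,q\}$ and every $i\in S$, $$Q_{ii}\ \ge\ \sum_{k\in S\setminus\{i\}}Q_{ik}\ -\sum_{\{a,b\}\in\binom{S\setminus\{i\}}{2}}Q_{ab},$$ where $\binom{S\setminus\{i\}}{2}$ denotes the set of $2$-element subsets of $S\setminus\{i\}$.
   Context: A finite abstract simplicial complex is determined by its facets (inclusion-maximal faces), and its vertex set is the union of its facets. For a complex with labeled (distinct) facets $F_1,\dots,F_q$, the facet-adjacency matrix is the $q\times q$ symmetric matrix $Q$ with $Q_{ij}=|F_i\cap F_j|$ (equivalently $Q=BB^T$, where $B$ is the $0/1$ matrix whose rows are indexed by facets and columns by vertices, with entry $1$ exactly when the facet contains the vertex). A $q\times q$ symmetric integer matrix is realizable if it is the facet-adjacency matrix of some simplicial complex with $q$ facets. *)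

theory Defs
  imports Jordan_Normal_Form.Matrix
begin

definition simplicial_complex :: "'v set set \<Rightarrow> bool" where
  "simplicial_complex K \<longleftrightarrow>
     finite K \<and> (\<forall>\<sigma>\<in>K. finite \<sigma>) \<and> (\<forall>\<sigma>\<in>K. \<forall>\<tau>. \<tau> \<subseteq> \<sigma> \<longrightarrow> \<tau> \<in> K)"

definition facets :: "'v set set \<Rightarrow> 'v set set" where
  "facets K = {\<sigma> \<in> K. \<forall>\<tau>\<in>K. \<sigma> \<subseteq> \<tau> \<longrightarrow> \<tau> = \<sigma>}"

text \<open>The \<open>q\<close> labels are \<open>0, \<dots>, q - 1\<close>, since entries of matrices are indexed from \<open>0\<close>.\<close>

definition facet_labelling :: "nat \<Rightarrow> 'v set set \<Rightarrow> (nat \<Rightarrow> 'v set) \<Rightarrow> bool" where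
  "facet_labelling q K F \<longleftrightarrow> bij_betw F {..<q} (facets K)"

definition facet_adjacency_mat :: "nat \<Rightarrow> (nat \<Rightarrow> 'v set) \<Rightarrow> int mat" where
  "facet_adjacency_mat q F = mat q q (\<lambda>(i, j). int (card (F i \<inter> F j)))"

text \<open>HOL cannot quantify over the type of vertices inside a definition. Taking the vertices to
  be natural numbers loses nothing, because complexes are finite; see \<open>realizableI\<close> below.\<close>

definition realizable :: "nat \<Rightarrow> int mat \<Rightarrow> bool" where
  "realizable q Q \<longleftrightarrow>
     (\<exists>(K :: nat set set) F. simplicial_complex K \<and> facet_labelling q K F \<and>
        Q = facet_adjacency_mat q F)"

lemma realizableI:
  fixes K :: "'v set set"
  assumes K: "simplicial_complex K" and F: "facet_labelling q K F"
  shows "realizable q (facet_adjacency_mat q F)"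
proof -
  have "finite (\<Union>K)"
    using K by (auto simp: simplicial_complex_def)
  then obtain g :: "'v \<Rightarrow> nat" where g: "inj_on g (\<Union>K)"
    using finite_imp_inj_to_nat_seg by blast
  have inj: "inj_on ((`) g) K"
    using g by (meson Union_upper inj_onI inj_on_image_eq_iff)
  have sub: "g ` \<sigma> \<subseteq> g ` \<tau> \<longleftrightarrow> \<sigma> \<subseteq> \<tau>" if "\<sigma> \<in> K" "\<tau> \<in> K" for \<sigma> \<tau>
    using inj_on_image_mem_iff[OF g] that by (auto simp: image_subset_iff) blast
  have eq: "g ` \<sigma> = g ` \<tau> \<longleftrightarrow> \<sigma> = \<tau>" if "\<sigma> \<in> K" "\<tau> \<in> K" for \<sigma> \<tau>
    using inj that by (auto simp: inj_on_def)
  have 1: "simplicial_complex ((`) g ` K)"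
    unfolding simplicial_complex_def
  proof (intro conjI ballI allI impI)
    show "finite ((`) g ` K)"
      using K by (simp add: simplicial_complex_def)
    show "finite \<sigma>" if "\<sigma> \<in> (`) g ` K" for \<sigma>
      using K that by (auto simp: simplicial_complex_def)
    show "\<tau> \<in> (`) g ` K" if \<sigma>: "\<sigma> \<in> (`) g ` K" and \<tau>: "\<tau> \<subseteq> \<sigma>" for \<sigma> \<tau>
    proof -
      from \<sigma> obtain \<rho> where \<rho>: "\<rho> \<in> K" "\<sigma> = g ` \<rho>"
        by blast
      with \<tau> obtain \<rho>' where "\<rho>' \<subseteq> \<rho>" "\<tau> = g ` \<rho>'"
        by (auto simp: subset_image_iff)
      with K \<rho> show ?thesis
        by (auto simp: simplicial_complex_def)
    qed
  qed
  have "facets ((`) g ` K) = (`) g ` facets K"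
    unfolding facets_def Compr_image_eq ball_simps
    by (intro arg_cong[where f = "image ((`) g)"] Collect_cong) (simp add: sub eq cong: conj_cong)
  moreover have FK: "F i \<in> K" if "i < q" for i
    using F that unfolding facet_labelling_def bij_betw_def facets_def by blast
  moreover have "bij_betw ((`) g) (facets K) ((`) g ` facets K)"
    by (rule inj_on_imp_bij_betw, rule inj_on_subset[OF inj]) (auto simp: facets_def)
  ultimately have 2: "facet_labelling q ((`) g ` K) ((`) g \<circ> F)"
    using F by (auto simp: facet_labelling_def intro: bij_betw_trans)
  have "card (g ` F i \<inter> g ` F j) = card (F i \<inter> F j)" if "i < q" "j < q" for i j
  proof -
    have "F i \<subseteq> \<Union>K" "F j \<subseteq> \<Union>K"
      using FK that by auto
    then have "g ` F i \<inter> g ` F j = g ` (F i \<inter> F j)" "inj_on g (F i \<inter> F j)"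
      using inj_on_image_Int[OF g] inj_on_subset[OF g, of "F i \<inter> F j"] by auto
    then show ?thesis
      by (simp add: card_image)
  qed
  then have "facet_adjacency_mat q F = facet_adjacency_mat q ((`) g \<circ> F)"
    unfolding facet_adjacency_mat_def by (intro eq_matI) auto
  with 1 2 show ?thesis
    unfolding realizable_def by blast
qed

end

theory Submission imports Defs begin

text \<open>Let \<open>F\<close> be a labelling of the facets and \<open>T = S - {i}\<close>. A vertex of \<open>F i\<close> that lies in
  exactly \<open>m\<close> of the facets \<open>F k\<close> with \<open>k \<in> T\<close> is counted \<open>m\<close> times by the sum over \<open>T\<close> and
  \<open>m choose 2\<close> times by the sum over pairs of \<open>T\<close>, and \<open>m - (m choose 2) \<le> 1\<close>. This is the second
  Bonferroni inequality (\<open>bonferroni_two\<close>) for the sets \<open>F i \<inter> F k\<close>, whose union lies in \<open>F i\<close> and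
  so has at most \<open>Q $$ (i, i)\<close> elements. There a pair \<open>{a, b}\<close> contributes only the vertices of
  \<open>F i \<inter> F a \<inter> F b\<close>; taking all of \<open>F a \<inter> F b\<close> instead enlarges the sum that is subtracted.\<close>

lemma pairs_insert:
  assumes "x \<notin> A"
  shows "{P. P \<subseteq> insert x A \<and> card P = 2} =
    {P. P \<subseteq> A \<and> card P = 2} \<union> (\<lambda>k. {x, k}) ` A"
  using assms by (auto simp: card_2_iff image_iff insert_commute)

text \<open>Induction on the index set: adding a set \<open>G x\<close> to a union \<open>U\<close> increases the cardinality by
  \<open>card (G x)\<close> minus that of the overlap \<open>G x \<inter> U\<close>. The overlap is the union of the sets
  \<open>G x \<inter> G k\<close>, so its cardinality is at most what the new pairs \<open>{x, k}\<close> contribute.\<close>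

lemma bonferroni_two:
  assumes "finite A" "\<And>k. k \<in> A \<Longrightarrow> finite (G k)"
  shows "(\<Sum>k\<in>A. card (G k)) \<le>
    card (\<Union>k\<in>A. G k) + (\<Sum>P \<in> {P. P \<subseteq> A \<and> card P = 2}. card (\<Inter>k\<in>P. G k))"
  using assms
proof (induction A rule: finite_induct)
  case empty
  then show ?case by simp
next
  case (insert x A)
  let ?U = "\<Union>k\<in>A. G k" and ?pairs = "{P. P \<subseteq> A \<and> card P = 2}"
  let ?c = "\<lambda>P. card (\<Inter>k\<in>P. G k)"
  have fin: "finite (G x)" "finite ?U"
    using insert by auto
  have "card (G x \<inter> ?U) = card (\<Union>k\<in>A. G x \<inter> G k)"
    by (rule arg_cong[where f = card]) auto
  also have "\<dots> \<le> (\<Sum>k\<in>A. card (G x \<inter> G k))"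
    by (rule card_UN_le[OF insert.hyps(1)])
  finally have overlap: "card (G x \<inter> ?U) \<le> (\<Sum>k\<in>A. card (G x \<inter> G k))" .
  have inj: "inj_on (\<lambda>k. {x, k}) A"
    by (auto simp: inj_on_def doubleton_eq_iff)
  have "sum ?c {P. P \<subseteq> insert x A \<and> card P = 2} = sum ?c ?pairs + sum ?c ((\<lambda>k. {x, k}) ` A)"
    unfolding pairs_insert[OF insert.hyps(2)]
    using insert.hyps by (intro sum.union_disjoint) auto
  also have "sum ?c ((\<lambda>k. {x, k}) ` A) = (\<Sum>k\<in>A. card (G x \<inter> G k))"
    by (simp add: sum.reindex[OF inj])
  finally have pairs: "sum ?c {P. P \<subseteq> insert x A \<and> card P = 2} =
    sum ?c ?pairs + (\<Sum>k\<in>A. card (G x \<inter> G k))" .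
  have "card (G x) + card ?U = card (G x \<union> ?U) + card (G x \<inter> ?U)"
    by (rule card_Un_Int[OF fin])
  moreover have "(\<Sum>k\<in>A. card (G k)) \<le> card ?U + sum ?c ?pairs"
    using insert by simp
  ultimately show ?case
    using overlap pairs insert.hyps by simp
qed

theorem proposition2p3:
  fixes q :: nat and Q :: "int mat" and S :: "nat set" and i :: nat
  assumes "realizable q Q"
    and "S \<subseteq> {..<q}"
    and "i \<in> S"
  shows "Q $$ (i, i) \<ge>
    (\<Sum>k \<in> S - {i}. Q $$ (i, k)) -
    (\<Sum>P \<in> {P. P \<subseteq> S - {i} \<and> card P = 2}. Q $$ (Min P, Max P))"
proof -
  obtain K :: "nat set set" and F where K: "simplicial_complex K"
    and F: "facet_labelling q K F" and Q: "Q = facet_adjacency_mat q F"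
    using assms(1) unfolding realizable_def by blast
  define T where "T = S - {i}"
  have T: "finite T" "T \<subseteq> {..<q}" and i: "i < q"
    using assms(2,3) finite_subset[OF assms(2)] by (auto simp: T_def)
  have entry: "Q $$ (a, b) = int (card (F a \<inter> F b))" if "a < q" "b < q" for a b
    using that by (simp add: Q facet_adjacency_mat_def)
  have finF: "finite (F k)" if "k < q" for k
  proof -
    have "F k \<in> facets K"
      using F that unfolding facet_labelling_def bij_betw_def by blast
    then show ?thesis
      using K by (simp add: simplicial_complex_def facets_def)
  qed
  let ?G = "\<lambda>k. F i \<inter> F k" and ?pairs = "{P. P \<subseteq> T \<and> card P = 2}"
  have pair: "int (card (\<Inter>k\<in>P. ?G k)) \<le> Q $$ (Min P, Max P)" if "P \<in> ?pairs" for P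
  proof -
    have "finite P" "P \<noteq> {}"
      using that card_ge_0_finite[of P] by auto
    then have "Min P \<in> P" "Max P \<in> P"
      by auto
    then have "Min P < q" "Max P < q" and sub: "(\<Inter>k\<in>P. ?G k) \<subseteq> F (Min P) \<inter> F (Max P)"
      using that T(2) by blast+
    then show ?thesis
      using finF by (simp add: entry card_mono)
  qed
  have "(\<Sum>k\<in>T. card (?G k)) \<le> card (\<Union>k\<in>T. ?G k) + (\<Sum>P\<in>?pairs. card (\<Inter>k\<in>P. ?G k))"
    using T(1) finF[OF i] by (intro bonferroni_two) auto
  also have "card (\<Union>k\<in>T. ?G k) \<le> card (F i)"
    using finF[OF i] by (intro card_mono) auto
  finally have "int (\<Sum>k\<in>T. card (?G k)) \<le>
    int (card (F i)) + int (\<Sum>P\<in>?pairs. card (\<Inter>k\<in>P. ?G k))"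
    by linarith
  moreover have "int (\<Sum>P\<in>?pairs. card (\<Inter>k\<in>P. ?G k)) \<le> (\<Sum>P\<in>?pairs. Q $$ (Min P, Max P))"
    unfolding of_nat_sum by (rule sum_mono[OF pair])
  moreover have "(\<Sum>k\<in>T. Q $$ (i, k)) = int (\<Sum>k\<in>T. card (?G k))"
    unfolding of_nat_sum using T(2) i by (intro sum.cong) (auto simp: entry)
  moreover have "Q $$ (i, i) = int (card (F i))"
    using i by (simp add: entry)
  ultimately show ?thesis
    unfolding T_def by linarith
qed

end
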